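(* For every $p\in(0,1)$, every $w_0\in\mathbb{C}\setminus\{0\}$ and every $f\in\Sigma^*(p,w_0)$, one has $\operatorname{Re} a_2(f)>0$.
   Context: Let $\mathbb{D}=\{z\in\mathbb{C}:|z|<1\}$ and $\overline{\mathbb{C}}=\mathbb{C}\cup\{\infty\}$. For $p\in(0,1)$ and a finite point $w_0\in\mathbb{C}$, $w_0\neq 0$, $\Sigma^*(p,w_0)$ denotes the class of functions $f$ that are meromorphic and univalent (injective) in $\mathbb{D}$, with a simple pole at $z=p$ and no other pole, normalized by $f(0)=0$ and $f'(0)=1$, and such that the complement $\overline{\mathbb{C}}\setminus f(\mathbb{D})$ is a starlike set with respect to $w_0$ (it contains $w_0$ and, with each of its points $w$, the line segment from $w_0$ to $w$). Each $f\in\Sigma^*(p,w_0)$ has a Taylor expansion $f(z)=z+\sum_{n=2}^{\infty}a_n(f)z^n$ for $|z|<p$, which defines $a_2(f)$. *)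

theory Defs
  imports "HOL-Complex_Analysis.Complex_Analysis"
begin

definition starlike_wrt :: "complex \<Rightarrow> complex set \<Rightarrow> bool" where
  "starlike_wrt w0 E \<longleftrightarrow> w0 \<in> E \<and> (\<forall>w\<in>E. closed_segment w0 w \<subseteq> E)"

(* The value f p that HOL assigns at the pole is arbitrary and is never used. As a map into the
   Riemann sphere, f sends p, and only p, to infinity. Hence injectivity on the disc is injectivity
   on the disc without p, and the complement of f(disc) in the sphere does not contain infinity:
   it is the complement in the plane of the image of the disc without p. *)
definition Sigma_star :: "real \<Rightarrow> complex \<Rightarrow> (complex \<Rightarrow> complex) set" where
  "Sigma_star p w0 = {f.
     f meromorphic_on ball 0 1 \<and>
     f holomorphic_on ball 0 1 - {of_real p} \<and>
     is_pole f (of_real p) \<and> zorder f (of_real p) = -1 \<and>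
     inj_on f (ball 0 1 - {of_real p}) \<and>
     f 0 = 0 \<and> deriv f 0 = 1 \<and>
     starlike_wrt w0 (- (f ` (ball 0 1 - {of_real p})))}"

end

theory Submission
  imports Defs
begin

text \<open>
  The function \<open>F = 1 / (f - w0)\<close> is univalent in the disc, vanishes at \<open>p\<close>, and its image is
  starlike with respect to 0. After moving \<open>p\<close> to 0 by a Moebius map it becomes an ordinary univalent
  starlike function \<open>H\<close>, for which \<open>Re (z H' / H) \<ge> 0\<close>, because the maps taking \<open>z\<close> to the preimage of
  \<open>\<tau> H z\<close> fix 0 and hence do not increase the norm. The Cayley transform turns this into a differential
  equation for \<open>f\<close> whose parameter is a holomorphic function \<open>\<phi>\<close> bounded by 1. With
  \<open>A = p + 1 / p > 2\<close>, its coefficients at 0 give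
  \<open>a2 = A + (\<phi>(0)^2 - 1 - \<phi>'(0)) / (A - 2 \<phi>(0))\<close>, and the Schwarz-Pick bound
  \<open>\<bar>\<phi>'(0)\<bar> \<le> 1 - \<bar>\<phi>(0)\<bar>^2\<close> makes the real part positive.
\<close>

section \<open>Bounded holomorphic functions on the unit disc\<close>

text \<open>Maximum modulus principle. The dichotomy supplies the strict bound that the Schwarz
  lemma asks for when only the weak bound is known.\<close>

lemma bounded_holomorphic_on_disc_strict_or_constant:
  assumes hol: "f holomorphic_on ball 0 1" and le: "\<forall>z. norm z < 1 \<longrightarrow> norm (f z) \<le> 1"
  obtains "\<forall>z. norm z < 1 \<longrightarrow> norm (f z) < 1"
    | c where "norm c = 1" "\<forall>z. norm z < 1 \<longrightarrow> f z = c"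
proof (cases "\<exists>\<xi>. norm \<xi> < 1 \<and> norm (f \<xi>) = 1")
  case True
  then obtain \<xi> where \<xi>: "norm \<xi> < 1" "norm (f \<xi>) = 1" by blast
  have "f constant_on ball 0 1"
    by (rule maximum_modulus_principle[OF hol _ _ _ order_refl, of \<xi>]) (use \<xi> le in auto)
  then obtain c where "\<forall>z. norm z < 1 \<longrightarrow> f z = c" unfolding constant_on_def by (metis mem_ball_0)
  with \<xi> that(2) show thesis by metis
next
  case False
  with le that(1) show thesis by (meson order_le_imp_less_or_eq)
qed

text \<open>The Schwarz lemma applies to \<open>f\<close> followed by the disc automorphism that
  sends \<open>f 0\<close> to 0, whose derivative at \<open>f 0\<close> is
  \<open>1 / (1 - (norm (f 0))\<^sup>2)\<close>. If the modulus 1 is attained, \<open>f\<close> is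
  constant and both sides are 0.\<close>

lemma Schwarz_Pick_deriv_0:
  assumes hol: "f holomorphic_on ball 0 1" and le: "\<forall>z. norm z < 1 \<longrightarrow> norm (f z) \<le> 1"
  shows "norm (deriv f 0) \<le> 1 - (norm (f 0))\<^sup>2"
proof (cases rule: bounded_holomorphic_on_disc_strict_or_constant[OF hol le])
  case 1
  define a where "a = f 0"
  define g where "g = (\<lambda>z. Moebius_function 0 a (f z))"
  have a: "norm a < 1" using 1 by (simp add: a_def)
  have sq: "1 - cnj a * a = of_real (1 - (norm a)\<^sup>2)"
    by (metis complex_norm_square mult.commute of_real_1 of_real_diff)
  have pos: "1 - (norm a)\<^sup>2 > 0" using a by (simp add: power_less_one_iff abs_square_less_1)
  have "1 - cnj a * a \<noteq> 0" using pos unfolding sq by (metis less_irrefl of_real_eq_0_iff)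
  then have "(Moebius_function 0 a has_field_derivative 1 / (1 - cnj a * a)) (at a)"
    unfolding Moebius_function_simple[abs_def] by (auto intro!: derivative_eq_intros)
  then have dM: "(Moebius_function 0 a has_field_derivative 1 / of_real (1 - (norm a)\<^sup>2)) (at (f 0))"
    unfolding sq a_def[symmetric] .
  have "(f has_field_derivative deriv f 0) (at 0)"
    using hol by (auto intro: holomorphic_derivI)
  with dM have "(g has_field_derivative 1 / of_real (1 - (norm a)\<^sup>2) * deriv f 0) (at 0)"
    unfolding g_def by (rule DERIV_chain2)
  then have dg: "deriv g 0 = deriv f 0 / of_real (1 - (norm a)\<^sup>2)"
    by (simp add: DERIV_imp_deriv)
  have "g holomorphic_on ball 0 1"
    unfolding g_def using holomorphic_on_compose_gen[OF hol Moebius_function_holomorphic[OF a]] 1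
    by (force simp: o_def)
  moreover have "norm (g z) < 1" if "norm z < 1" for z
    unfolding g_def using Moebius_function_norm_lt_1[OF a] 1 that by blast
  ultimately have "norm (deriv g 0) \<le> 1"
    using Schwarz_Lemma(2)[of g 0] by (simp add: g_def a_def Moebius_function_eq_zero)
  then show ?thesis
    using pos unfolding dg a_def[symmetric] norm_divide norm_of_real by (simp add: divide_le_eq)
next
  case (2 c)
  have "deriv f 0 = deriv (\<lambda>_. c) 0"
    by (rule complex_derivative_transform_within_open[of _ "ball 0 1"]) (use hol 2 in auto)
  with 2 show ?thesis by simp
qed

section \<open>Starlike univalent functions\<close>

text \<open>Let \<open>u \<tau>\<close> be the preimage of \<open>\<tau> * H z\<close>. The
  derivative of its squared norm at 1 is twice the squared norm of \<open>z\<close> times the real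
  part of \<open>H z / (z * deriv H z)\<close>, and passing to the reciprocal preserves the sign of
  a real part. At \<open>z = 0\<close> the quotient is 0 / 0, which is 0 in HOL, so the claim is
  trivial there.\<close>

lemma starlike_univalent_imp_Re_nonneg:
  assumes hol: "H holomorphic_on ball 0 1" and inj: "inj_on H (ball 0 1)" and 0: "H 0 = 0"
    and star: "\<And>z \<tau>. norm z < 1 \<Longrightarrow> 0 \<le> \<tau> \<Longrightarrow> \<tau> \<le> 1 \<Longrightarrow> of_real \<tau> * H z \<in> H ` ball 0 1"
    and z: "norm z < 1"
  shows "Re (z * deriv H z / H z) \<ge> 0"
proof (cases "z = 0")
  case False
  obtain G where G: "G holomorphic_on H ` ball 0 1"
      "\<And>z. z \<in> ball 0 1 \<Longrightarrow> deriv H z * deriv G (H z) = 1"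
      "\<And>z. z \<in> ball 0 1 \<Longrightarrow> G (H z) = z"
    using holomorphic_has_inverse[OF hol open_ball inj] by metis
  have opn: "open (H ` ball 0 1)" using open_mapping_thm3[OF hol open_ball inj] .
  define c where "c = H z"
  have c: "c \<noteq> 0" using inj_onD[OF inj, of z 0] z False 0 by (auto simp: c_def)
  have G_in: "norm (G w) < 1" if "w \<in> H ` ball 0 1" for w using that G(3) by auto
  \<comment> \<open>Starlikeness keeps \<open>\<tau> * H \<zeta>\<close> in the domain of the
    inverse \<open>G\<close>, so \<open>\<omega>\<close> maps the disc into itself and fixes 0; the
    Schwarz lemma is then used at \<open>z\<close>.\<close>
  have shrink: "norm (G (of_real \<tau> * c)) \<le> norm z" if \<tau>: "0 \<le> \<tau>" "\<tau> \<le> 1" for \<tau>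
  proof -
    define \<omega> where "\<omega> = (\<lambda>\<zeta>. G (of_real \<tau> * H \<zeta>))"
    have "\<omega> holomorphic_on ball 0 1"
      unfolding \<omega>_def
      by (rule holomorphic_on_compose_gen[of "\<lambda>\<zeta>. of_real \<tau> * H \<zeta>" _ G "H ` ball 0 1", unfolded o_def])
         (use hol G(1) star \<tau> in \<open>auto intro!: holomorphic_intros\<close>)
    moreover have "\<omega> 0 = 0" using G(3)[of 0] 0 by (simp add: \<omega>_def)
    ultimately show ?thesis
      using Schwarz_Lemma(1)[of \<omega> z] G_in star \<tau> z by (auto simp: \<omega>_def c_def)
  qed
  \<comment> \<open>By the Schwarz lemma the norm of \<open>u \<tau>\<close> on \<open>[0,1]\<close> is maximal at \<open>\<tau> = 1\<close>, so the derivative there is nonnegative.\<close>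
  define u where "u = (\<lambda>\<tau>::real. G (of_real \<tau> * c))"
  have "(G has_field_derivative deriv G c) (at (of_real 1 * c))"
    using holomorphic_derivI[OF G(1) opn, of c] z by (auto simp: c_def)
  then have "((\<lambda>w. G (w * c)) has_field_derivative deriv G c * c) (at (of_real 1))"
    by (rule DERIV_chain2) (auto intro!: derivative_eq_intros)
  then have du: "(u has_vector_derivative deriv G c * c) (at 1)"
    unfolding u_def by (rule has_vector_derivative_real_field)
  have u1: "u 1 = z" using G(3) z by (auto simp: u_def c_def)
  have "((\<lambda>\<tau>. u \<tau> \<bullet> u \<tau>) has_real_derivative 2 * (z \<bullet> (deriv G c * c))) (at 1)"
  proof -
    have "((\<lambda>\<tau>. u \<tau> \<bullet> u \<tau>) has_derivative (\<lambda>h. u 1 \<bullet> (h *\<^sub>R (deriv G c * c)) + (h *\<^sub>R (deriv G c * c)) \<bullet> u 1)) (at 1)"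
      using du unfolding has_vector_derivative_def by (rule has_derivative_inner[OF _ ]) (use du in \<open>simp add: has_vector_derivative_def\<close>)
    then show ?thesis
      unfolding has_field_derivative_def
      by (rule has_derivative_eq_rhs) (auto simp: u1 inner_commute fun_eq_iff)
  qed
  then have "z \<bullet> (deriv G c * c) \<ge> 0"
  proof -
    assume d: "((\<lambda>\<tau>. u \<tau> \<bullet> u \<tau>) has_real_derivative 2 * (z \<bullet> (deriv G c * c))) (at 1)"
    show ?thesis
    proof (rule ccontr)
      assume "\<not> ?thesis"
      then obtain \<delta> where \<delta>: "\<delta> > 0" "\<And>h. h > 0 \<Longrightarrow> h < \<delta> \<Longrightarrow> u 1 \<bullet> u 1 < u (1 - h) \<bullet> u (1 - h)"
        using DERIV_neg_dec_left[OF d] by auto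
      \<comment> \<open>The cap at 1 keeps \<open>1 - h\<close> in the interval from 0 to 1, where
        \<open>shrink\<close> applies; halving \<open>\<delta>\<close> keeps \<open>h\<close>
        strictly below it.\<close>
      define h where "h = min (\<delta> / 2) 1"
      have "u 1 \<bullet> u 1 < u (1 - h) \<bullet> u (1 - h)" using \<delta> by (auto simp: h_def min_def)
      moreover have "norm (u (1 - h)) \<le> norm z"
        using shrink[of "1 - h"] \<delta>(1) by (auto simp: u_def h_def)
      ultimately show False
        unfolding u1 dot_square_norm using power_mono[of "norm (u (1 - h))" "norm z" 2] by (meson norm_ge_zero not_less)
    qed
  qed
  \<comment> \<open>The derivative of \<open>u\<close> at 1 is thus \<open>v * z\<close> with
    \<open>v\<close> the reciprocal of \<open>z * deriv H z / c\<close>. Its inner product with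
    \<open>z\<close> is a positive multiple of \<open>Re v\<close>.\<close>
  moreover have "deriv G c * c = inverse (z * deriv H z / c) * z"
  proof -
    have "deriv H z * deriv G c = 1" using G(2) z by (simp add: c_def)
    then have "deriv G c = inverse (deriv H z)" by (metis inverse_unique)
    then show ?thesis using False by (simp add: field_simps)
  qed
  moreover have "z \<bullet> (v * z) = Re v * (norm z)\<^sup>2" for v
    unfolding inner_complex_def cmod_power2 by (simp add: algebra_simps power2_eq_square)
  ultimately have Re_inv: "Re (inverse (z * deriv H z / c)) \<ge> 0"
    using False by (simp only: zero_le_mult_iff) auto
  have "Re v \<ge> 0" if "Re (inverse v) \<ge> 0" for v
  proof (cases "v = 0")
    case False
    then have "(Re v)\<^sup>2 + (Im v)\<^sup>2 > 0" by (simp add: cmod_power2[symmetric])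
    with that show ?thesis by (simp add: zero_le_divide_iff)
  qed simp
  from this[OF Re_inv] show ?thesis unfolding c_def .
qed simp

text \<open>The quotient \<open>z * deriv H z / H z\<close> has nonnegative real part and limit 1 at
  0, so its Cayley transform is bounded by 1 and vanishes at 0. By the Schwarz lemma it equals
  \<open>z * \<kappa> z\<close> with \<open>\<kappa>\<close> bounded by 1. Clearing denominators
  makes the equation meaningful at 0 as well.\<close>

lemma starlike_univalent_Schur_function:
  assumes hol: "H holomorphic_on ball 0 1" and inj: "inj_on H (ball 0 1)" and 0: "H 0 = 0"
    and star: "\<And>z \<tau>. norm z < 1 \<Longrightarrow> 0 \<le> \<tau> \<Longrightarrow> \<tau> \<le> 1 \<Longrightarrow> of_real \<tau> * H z \<in> H ` ball 0 1"
  obtains \<kappa> where "\<kappa> holomorphic_on ball 0 1" "\<And>z. norm z < 1 \<Longrightarrow> norm (\<kappa> z) \<le> 1"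
    "\<And>z. norm z < 1 \<Longrightarrow> z * deriv H z * (1 - z * \<kappa> z) = H z * (1 + z * \<kappa> z)"
proof -
  obtain M where M: "M holomorphic_on ball 0 1" "\<And>z. norm z < 1 \<Longrightarrow> H z = z * M z" "deriv H 0 = M 0"
    using Schwarz3[OF hol 0] by metis
  have M0: "M z \<noteq> 0" if "norm z < 1" for z
  proof (cases "z = 0")
    case True
    then show ?thesis using holomorphic_injective_imp_regular[OF hol open_ball inj, of 0] M(3) by simp
  next
    case False
    then show ?thesis using inj_onD[OF inj, of z 0] that 0 M(2)[OF that] by auto
  qed
  have dH: "deriv H z = M z + z * deriv M z" if "norm z < 1" for z
  proof -
    have "deriv H z = deriv (\<lambda>z. z * M z) z"
      by (rule complex_derivative_transform_within_open[of _ "ball 0 1"])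
         (use hol M that in \<open>auto intro!: holomorphic_intros\<close>)
    also have "\<dots> = M z + z * deriv M z"
      using holomorphic_derivI[OF M(1) open_ball, of z] that
      by (auto intro!: DERIV_imp_deriv derivative_eq_intros)
    finally show ?thesis .
  qed
  \<comment> \<open>This is the holomorphic extension of \<open>z * deriv H z / H z\<close> to 0,
    obtained from \<open>H z = z * M z\<close> with \<open>M\<close> free of zeros; its value at 0
    is 1.\<close>
  define q where "q = (\<lambda>z. 1 + z * deriv M z / M z)"
  have q: "z * deriv H z = H z * q z" if "norm z < 1" for z
    using M0[OF that] M(2)[OF that] dH[OF that] by (simp add: q_def field_simps)
  have Re_q: "Re (q z) \<ge> 0" if "norm z < 1" for z
  proof (cases "z = 0")
    case False
    then have "q z = z * deriv H z / H z"
      using q[OF that] M0[OF that] M(2)[OF that] by simp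
    then show ?thesis using starlike_univalent_imp_Re_nonneg[OF hol inj 0 star that] by simp
  qed (simp add: q_def)
  have q1: "q z + 1 \<noteq> 0" if "norm z < 1" for z
    using Re_q[OF that] by (auto simp: complex_eq_iff)
  define k where "k = (\<lambda>z. (q z - 1) / (q z + 1))"
  have k0: "k 0 = 0" by (simp add: k_def q_def)
  have holk: "k holomorphic_on ball 0 1"
    unfolding k_def using M(1) M0 q1 unfolding q_def by (auto intro!: holomorphic_intros)
  have k_le: "\<forall>z. norm z < 1 \<longrightarrow> norm (k z) \<le> 1"
  proof (intro allI impI)
    fix z :: complex
    assume that: "norm z < 1"
    have "(norm (q z - 1))\<^sup>2 \<le> (norm (q z + 1))\<^sup>2"
      using Re_q[OF that] unfolding cmod_power2 by (simp add: power2_eq_square algebra_simps)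
    then have "norm (q z - 1) \<le> norm (q z + 1)" using power2_le_imp_le norm_ge_zero by blast
    then show "norm (k z) \<le> 1" using q1[OF that] by (simp add: k_def norm_divide divide_le_eq)
  qed
  have k_lt: "norm (k z) < 1" if "norm z < 1" for z
    using that
  proof (cases rule: bounded_holomorphic_on_disc_strict_or_constant[OF holk k_le])
    case (2 c)
    then show ?thesis using k0 by (metis norm_zero zero_less_one zero_neq_one)
  qed auto
  obtain \<kappa> where \<kappa>: "\<kappa> holomorphic_on ball 0 1" "\<And>z. norm z < 1 \<Longrightarrow> k z = z * \<kappa> z" "deriv k 0 = \<kappa> 0"
    using Schwarz3[OF holk k0] by metis
  show thesis
  proof
    show "\<kappa> holomorphic_on ball 0 1" by fact
    \<comment> \<open>At 0 the value of \<open>\<kappa>\<close> is the derivative of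
      \<open>k\<close>, so the derivative part of the Schwarz lemma is needed; elsewhere
      \<open>\<kappa>\<close> is the quotient \<open>k z / z\<close>.\<close>
    show "norm (\<kappa> z) \<le> 1" if "norm z < 1" for z
    proof (cases "z = 0")
      case True
      then show ?thesis using Schwarz_Lemma(2)[OF holk k0 k_lt, of 0] \<kappa>(3) by simp
    next
      case False
      then show ?thesis
        using Schwarz_Lemma(1)[OF holk k0 k_lt that] \<kappa>(2)[OF that] by (simp add: norm_mult)
    qed
    show "z * deriv H z * (1 - z * \<kappa> z) = H z * (1 + z * \<kappa> z)" if "norm z < 1" for z
    proof -
      have "q z * (1 - k z) = 1 + k z" using q1[OF that] by (simp add: k_def field_simps)
      then show ?thesis using q[OF that] \<kappa>(2)[OF that] by (simp add: mult.assoc)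
    qed
  qed
qed

section \<open>Positivity of the coefficient expression\<close>

text \<open>After multiplication by the squared norm \<open>D\<close> of
  \<open>N = A - 2 * t\<close>, the real part is at least
  \<open>A * (d\<^sup>2 + 2 * y\<^sup>2) - s * d - s * norm N\<close>. Both subtracted terms are at
  most \<open>s * norm N\<close>, and \<open>A > 2\<close> bounds their sum by
  \<open>A * (s * norm N)\<close>. It remains to compare \<open>s * norm N\<close> with
  \<open>d\<^sup>2 + 2 * y\<^sup>2\<close>.\<close>

lemma coefficient_formula_Re_pos:
  fixes A :: real and t \<phi>1 :: complex
  assumes A: "A > 2" and t: "norm t \<le> 1" and \<phi>1: "norm \<phi>1 \<le> 1 - (norm t)\<^sup>2"
  shows "Re (of_real A + (t\<^sup>2 - 1 - \<phi>1) / (of_real A - 2 * t)) > 0"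
proof -
  define x y d s D where "x = Re t" and "y = Im t" and "d = A - 2 * x"
    and "s = 1 - (norm t)\<^sup>2" and "D = d\<^sup>2 + 4 * y\<^sup>2"
  have s: "s = 1 - x\<^sup>2 - y\<^sup>2" by (simp add: s_def x_def y_def cmod_power2)
  have s0: "s \<ge> 0" using t by (simp add: s_def power_le_one)
  have "2 * (1 - x) - (1 - x\<^sup>2) = (1 - x)\<^sup>2" by (simp add: power2_eq_square algebra_simps)
  then have "1 - x\<^sup>2 \<le> 2 * (1 - x)" using zero_le_power2[of "1 - x"] by linarith
  then have "1 - x\<^sup>2 < A - 2 * x" using A by argo
  then have sd: "s < d" using zero_le_power2[of y] unfolding s d_def by linarith
  define N where "N = of_real A - 2 * t"
  have N: "Re N = d" "Im N = - 2 * y" "(norm N)\<^sup>2 = D"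
    unfolding cmod_power2 by (simp_all add: N_def d_def x_def y_def D_def power_mult_distrib)
  have D0: "D > 0" using sd s0 by (simp add: D_def add_pos_nonneg)
  \<comment> \<open>Since \<open>d\<^sup>2 + 2 * y\<^sup>2\<close> is the mean of
    \<open>d\<^sup>2\<close> and \<open>D\<close>, this is the arithmetic-geometric mean inequality
    for \<open>d * norm N\<close>, made strict by \<open>s < d\<close>.\<close>
  have "s * norm N < d\<^sup>2 + 2 * y\<^sup>2"
  proof (rule power2_less_imp_less)
    have "(s * norm N)\<^sup>2 = s\<^sup>2 * D" by (simp add: power_mult_distrib N)
    also have "\<dots> < d\<^sup>2 * D" using D0 sd s0 by (simp add: power_strict_mono)
    also have "(d\<^sup>2 + 2 * y\<^sup>2)\<^sup>2 - d\<^sup>2 * D = (2 * y\<^sup>2)\<^sup>2"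
      by (simp add: D_def power2_eq_square algebra_simps)
    then have "d\<^sup>2 * D \<le> (d\<^sup>2 + 2 * y\<^sup>2)\<^sup>2" by (metis diff_ge_0_iff_ge zero_le_power2)
    finally show "(s * norm N)\<^sup>2 < (d\<^sup>2 + 2 * y\<^sup>2)\<^sup>2" .
  qed simp
  then have key: "A * (s * norm N) < A * (d\<^sup>2 + 2 * y\<^sup>2)" using A by simp
  have eq: "Re ((t\<^sup>2 - 1 - \<phi>1) * cnj N) = (x\<^sup>2 - y\<^sup>2 - 1) * d - 4 * x * y\<^sup>2 - Re (\<phi>1 * cnj N)"
    by (simp add: N left_diff_distrib x_def y_def power2_eq_square algebra_simps)
  have "Re (\<phi>1 * cnj N) \<le> norm (\<phi>1 * cnj N)" by (rule complex_Re_le_cmod)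
  also have "\<dots> \<le> s * norm N" using \<phi>1 by (simp add: norm_mult s_def mult_right_mono)
  finally have "Re (\<phi>1 * cnj N) \<le> s * norm N" .
  \<comment> \<open>The two terms in \<open>y\<^sup>2\<close> combine because
    \<open>d + 2 * x = A\<close>.\<close>
  moreover have "(x\<^sup>2 - y\<^sup>2 - 1) * d - 4 * x * y\<^sup>2 = - (s * d) - 2 * A * y\<^sup>2"
    by (simp add: s d_def power2_eq_square algebra_simps)
  moreover have "s * d \<le> s * norm N" using s0 complex_Re_le_cmod[of N] N by (simp add: mult_left_mono)
  moreover have "2 * (s * norm N) \<le> A * (s * norm N)" using A s0 by (simp add: mult_right_mono)
  moreover have "A * D = A * (d\<^sup>2 + 2 * y\<^sup>2) + 2 * A * y\<^sup>2" by (simp add: D_def algebra_simps)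
  ultimately have "A * D + Re ((t\<^sup>2 - 1 - \<phi>1) * cnj N) > 0"
    unfolding eq using key by linarith
  moreover have "Re ((t\<^sup>2 - 1 - \<phi>1) / N) = Re ((t\<^sup>2 - 1 - \<phi>1) * cnj N) / D"
    using N(3) by (simp add: complex_div_cnj[of _ N] flip: of_real_power)
  ultimately have "- A < Re ((t\<^sup>2 - 1 - \<phi>1) / N)"
    using D0 by (simp add: less_divide_eq)
  then show ?thesis by (simp add: N_def)
qed


section \<open>From concave maps with a pole to starlike univalent maps\<close>

text \<open>Inversion about \<open>w0\<close> turns moving away from \<open>w0\<close> along a ray
  into moving towards 0. Starlikeness of the complement says that the image of \<open>f\<close>
  contains, with each point, the rest of its ray from \<open>w0\<close>; so the image of
  \<open>F\<close> is starlike about 0. The value 0 at the pole removes the singularity.\<close>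

lemma Sigma_star_reciprocal:
  fixes p :: real
  assumes p: "0 < p" "p < 1" and f: "f \<in> Sigma_star p w0"
  defines "F \<equiv> \<lambda>z. if z = of_real p then 0 else inverse (f z - w0)"
  shows "F holomorphic_on ball 0 1" "inj_on F (ball 0 1)"
    and "\<And>z. z \<in> ball 0 1 - {of_real p} \<Longrightarrow> f z \<noteq> w0"
    and "\<And>z \<tau>. norm z < 1 \<Longrightarrow> 0 \<le> \<tau> \<Longrightarrow> \<tau> \<le> 1 \<Longrightarrow> of_real \<tau> * F z \<in> F ` ball 0 1"
proof -
  define U where "U = ball 0 1 - {complex_of_real p}"
  have hol: "f holomorphic_on U" and pole: "is_pole f (of_real p)" and inj: "inj_on f U"
    and star: "starlike_wrt w0 (- (f ` U))"
    using f by (auto simp: Sigma_star_def U_def)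
  have p1: "complex_of_real p \<in> ball 0 1" using p by simp
  show ne: "f z \<noteq> w0" if "z \<in> ball 0 1 - {of_real p}" for z
    using star that by (auto simp: starlike_wrt_def U_def)
  have "is_pole (\<lambda>z. f z - w0) (of_real p)"
    using pole by (simp add: is_pole_minus_const_iff)
  then show "F holomorphic_on ball 0 1"
    unfolding F_def using ne hol
    by (intro is_pole_inverse_holomorphic) (auto intro!: holomorphic_intros simp: U_def)
  show "inj_on F (ball 0 1)"
  proof (rule inj_onI)
    fix x y
    assume "x \<in> ball 0 1" "y \<in> ball 0 1" "F x = F y"
    then show "x = y"
      using ne[of x] ne[of y] inj_onD[OF inj, of x y] by (simp add: F_def U_def split: if_splits)
  qed
  show "of_real \<tau> * F z \<in> F ` ball 0 1" if z: "norm z < 1" and \<tau>: "0 \<le> \<tau>" "\<tau> \<le> 1" for z \<tau>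
  proof (cases "\<tau> = 0 \<or> z = of_real p")
    case True
    then have "of_real \<tau> * F z = F (of_real p)" by (auto simp: F_def)
    then show ?thesis using p1 by simp
  next
    case False
    \<comment> \<open>This point lies on the ray from \<open>w0\<close> through \<open>f z\<close>,
      at or beyond \<open>f z\<close>, and is chosen so that inverting \<open>w - w0\<close> gives
      \<open>\<tau> * F z\<close>. If it were in the complement, so would be
      \<open>f z\<close>.\<close>
    define w where "w = w0 + (f z - w0) / of_real \<tau>"
    have "of_real \<tau> * (w - w0) = f z - w0" using False by (simp add: w_def)
    then have "f z = (1 - \<tau>) *\<^sub>R w0 + \<tau> *\<^sub>R w"
      by (simp add: scaleR_conv_of_real algebra_simps)
    then have "f z \<in> closed_segment w0 w" using \<tau> by (auto simp: in_segment)
    moreover have "f z \<in> f ` U" using z False by (auto simp: U_def)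
    ultimately have "w \<in> f ` U" using star unfolding starlike_wrt_def by blast
    then obtain \<zeta> where \<zeta>: "\<zeta> \<in> U" "w = f \<zeta>" by blast
    have "F \<zeta> = of_real \<tau> * F z"
      using \<zeta>(1) False unfolding F_def \<zeta>(2)[symmetric] by (simp add: U_def w_def divide_inverse)
    then show ?thesis using \<zeta>(1) unfolding U_def by (metis DiffD1 imageI)
  qed
qed

text \<open>The automorphism \<open>m\<close> takes 0 to the pole, so \<open>F\<close> composed with
  \<open>m\<close> is starlike and univalent with zero at 0, and its equation is pulled back by the
  inverse \<open>T\<close>. Clearing denominators leaves an equation that can be evaluated and
  differentiated at 0, which is how the second coefficient is reached.\<close>

lemma Sigma_star_Schur_function:
  fixes p :: real
  assumes p: "0 < p" "p < 1" and f: "f \<in> Sigma_star p w0"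
  obtains \<phi> where "\<phi> holomorphic_on ball 0 1" "\<And>z. norm z < 1 \<Longrightarrow> norm (\<phi> z) \<le> 1"
    "\<And>z. z \<in> ball 0 1 - {of_real p} \<Longrightarrow>
       (z - of_real p) * (1 - of_real p * z) * deriv f z * (1 - z * \<phi> z) =
       (w0 - f z) * ((1 + (of_real p)\<^sup>2) * (1 + z * \<phi> z) - 2 * of_real p * (\<phi> z + z))"
proof -
  define P where "P = complex_of_real p"
  define F where "F = (\<lambda>z. if z = P then 0 else inverse (f z - w0))"
  define T m where "T = Moebius_function 0 P" and "m = Moebius_function 0 (- P)"
  note F = Sigma_star_reciprocal(1-3)[OF p f, folded P_def, folded F_def]
  have F_star: "of_real \<tau> * F z \<in> F ` ball 0 1" if "norm z < 1" "0 \<le> \<tau>" "\<tau> \<le> 1" for z \<tau>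
    using Sigma_star_reciprocal(4)[OF p f that] unfolding F_def P_def .
  have P1: "norm P < 1" "norm (- P) < 1" using p by (auto simp: P_def)
  have T1: "norm (T z) < 1" and m1: "norm (m z) < 1" if "norm z < 1" for z
    unfolding T_def m_def using Moebius_function_norm_lt_1 P1 that by auto
  have mT: "m (T z) = z" and Tm: "T (m z) = z" if "norm z < 1" for z
    unfolding T_def m_def using Moebius_function_compose P1 that by auto
  have holT: "T holomorphic_on ball 0 1" and holm: "m holomorphic_on ball 0 1"
    unfolding T_def m_def using Moebius_function_holomorphic P1 by auto
  define H where "H = F \<circ> m"
  have holH: "H holomorphic_on ball 0 1"
    unfolding H_def using holm F(1) by (rule holomorphic_on_compose_gen) (auto simp: m1)
  have "inj_on m (ball 0 1)" by (rule inj_on_inverseI[of _ T]) (auto simp: Tm)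
  then have "inj_on H (ball 0 1)"
    unfolding H_def using F(2) by (intro comp_inj_on) (auto intro: inj_on_subset simp: m1)
  moreover have "H 0 = 0" by (simp add: H_def m_def F_def Moebius_function_def)
  moreover have "of_real \<tau> * H z \<in> H ` ball 0 1" if "norm z < 1" "0 \<le> \<tau>" "\<tau> \<le> 1" for z \<tau>
  proof -
    from F_star[OF m1[OF that(1)] that(2,3)]
    obtain \<zeta> where "norm \<zeta> < 1" "of_real \<tau> * F (m z) = F \<zeta>" by auto
    then have "of_real \<tau> * H z = H (T \<zeta>)" "T \<zeta> \<in> ball 0 1" by (auto simp: H_def mT T1)
    then show ?thesis by simp
  qed
  ultimately obtain \<kappa> where \<kappa>: "\<kappa> holomorphic_on ball 0 1" "\<And>z. norm z < 1 \<Longrightarrow> norm (\<kappa> z) \<le> 1"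
      "\<And>z. norm z < 1 \<Longrightarrow> z * deriv H z * (1 - z * \<kappa> z) = H z * (1 + z * \<kappa> z)"
    using starlike_univalent_Schur_function[OF holH] by metis
  \<comment> \<open>The Moebius transform from \<open>\<psi>\<close> to \<open>\<phi>\<close> moves the base point of the parametrisation from the pole to 0:
    \<open>(1 + z \<phi>) / (1 - z \<phi>) = - z f' / (f - w0) - p / (z - p) + p z / (1 - p z)\<close>.\<close>
  define \<psi> \<phi> where "\<psi> = \<kappa> \<circ> T" and "\<phi> = (\<lambda>z. (P + \<psi> z) / (1 + P * \<psi> z))"
  have \<psi>: "norm (\<psi> z) \<le> 1" if "norm z < 1" for z using \<kappa>(2) T1 that by (simp add: \<psi>_def)
  have hol\<psi>: "\<psi> holomorphic_on ball 0 1"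
    unfolding \<psi>_def using holT \<kappa>(1) by (rule holomorphic_on_compose_gen) (auto simp: T1)
  \<comment> \<open>Taken at \<open>\<psi> z\<close>, \<open>- z\<close> and \<open>- P\<close>,
    this shows that the quantities \<open>v\<close>, \<open>u\<close> and \<open>e\<close> below are
    nonzero.\<close>
  have neq: "1 + P * w \<noteq> 0" if "norm w \<le> 1" for w
  proof -
    have "norm (P * w) \<le> norm P * 1" unfolding norm_mult using that by (intro mult_left_mono) auto
    then have "norm (P * w) < 1" using P1 by simp
    then show ?thesis by (metis add_eq_0_iff less_irrefl norm_minus_cancel norm_one)
  qed
  show thesis
  proof (rule that[folded P_def])
    show "\<phi> holomorphic_on ball 0 1"
      unfolding \<phi>_def using neq \<psi> by (intro holomorphic_intros hol\<psi>) auto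
    show "norm (\<phi> z) \<le> 1" if "norm z < 1" for z
    proof -
      \<comment> \<open>This is the Schwarz-Pick identity for the disc automorphism with real
        parameter \<open>P\<close>, evaluated at \<open>\<psi> z\<close>.\<close>
      have "(norm (1 + P * \<psi> z))\<^sup>2 - (norm (P + \<psi> z))\<^sup>2 = (1 - p\<^sup>2) * (1 - (norm (\<psi> z))\<^sup>2)"
        unfolding cmod_power2 by (simp add: P_def power2_eq_square algebra_simps)
      also have "\<dots> \<ge> 0" using p \<psi>[OF that] by (simp add: power_le_one)
      finally have "norm (P + \<psi> z) \<le> norm (1 + P * \<psi> z)"
        using power2_le_imp_le[OF _ norm_ge_zero] by (metis diff_ge_0_iff_ge)
      then show ?thesis using neq[OF \<psi>[OF that]] by (simp add: \<phi>_def norm_divide divide_le_eq)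
    qed
    show "(z - P) * (1 - P * z) * deriv f z * (1 - z * \<phi> z) =
       (w0 - f z) * ((1 + P\<^sup>2) * (1 + z * \<phi> z) - 2 * P * (\<phi> z + z))"
      if z: "z \<in> ball 0 1 - {P}" for z
    proof -
      have z1: "norm z < 1" and zP: "z \<noteq> P" using z by auto
      define u v g e where "u = 1 - P * z" and "v = 1 + P * \<psi> z" and "g = f z - w0" and "e = 1 - P\<^sup>2"
      have u: "u \<noteq> 0" using neq[of "- z"] z1 by (simp add: u_def)
      have v: "v \<noteq> 0" using neq[OF \<psi>[OF z1]] by (simp add: v_def)
      have g: "g \<noteq> 0" using F(3)[OF z] by (simp add: g_def)
      have e: "e \<noteq> 0" using neq[of "- P"] P1 by (simp add: e_def power2_eq_square)
      have Tz: "T z = (z - P) / u" by (simp add: T_def Moebius_function_simple P_def u_def)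
      have "(T has_field_derivative (u + (z - P) * P) / u\<^sup>2) (at z)"
        unfolding T_def Moebius_function_simple[abs_def] using u
        by (auto intro!: derivative_eq_intros simp: P_def u_def power2_eq_square)
      moreover have "u + (z - P) * P = e" by (simp add: u_def e_def power2_eq_square algebra_simps)
      ultimately have dT: "(T has_field_derivative e / u\<^sup>2) (at z)" by simp
      \<comment> \<open>Off the pole, \<open>H (T x)\<close> is the reciprocal of
        \<open>f x - w0\<close>. Differentiating it in both forms expresses
        \<open>deriv H (T z)\<close> through \<open>deriv f z\<close>.\<close>
      have "(H has_field_derivative deriv H (T z)) (at (T z))"
        using holomorphic_derivI[OF holH open_ball] T1[OF z1] by simp
      then have 1: "((\<lambda>x. H (T x)) has_field_derivative deriv H (T z) * (e / u\<^sup>2)) (at z)"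
        using dT by (rule DERIV_chain2)
      have U: "open (ball 0 1 - {P})" by (simp add: open_Diff)
      have "f holomorphic_on ball 0 1 - {P}" using f by (simp add: Sigma_star_def P_def)
      from holomorphic_derivI[OF this U z]
      have "((\<lambda>x. inverse (f x - w0)) has_field_derivative - (deriv f z / g\<^sup>2)) (at z)"
        using g by (auto intro!: derivative_eq_intros simp: g_def power2_eq_square divide_inverse)
      then have "((\<lambda>x. H (T x)) has_field_derivative - (deriv f z / g\<^sup>2)) (at z)"
        by (rule has_field_derivative_transform_within_open[OF _ U z])
           (auto simp: H_def mT F_def)
      with 1 have "deriv H (T z) * (e / u\<^sup>2) = - (deriv f z / g\<^sup>2)" by (rule DERIV_unique)
      then have dH: "deriv H (T z) = - (deriv f z * u\<^sup>2 / (e * g\<^sup>2))"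
        using u e g by (simp add: field_simps)
      have HT: "H (T z) = 1 / g" using zP by (simp add: H_def mT z1 F_def g_def divide_inverse)
      have "T z * deriv H (T z) * (1 - T z * \<psi> z) = H (T z) * (1 + T z * \<psi> z)"
        using \<kappa>(3)[OF T1[OF z1]] by (simp add: \<psi>_def)
      then have "(z - P) / u * (- (deriv f z * u\<^sup>2 / (e * g\<^sup>2))) * (1 - (z - P) / u * \<psi> z) =
          1 / g * (1 + (z - P) / u * \<psi> z)"
        unfolding dH HT unfolding Tz .
      \<comment> \<open>The factor is the product of the denominators that remain in the two
        sides.\<close>
      then have "e * g\<^sup>2 * u * ((z - P) / u * (- (deriv f z * u\<^sup>2 / (e * g\<^sup>2))) * (1 - (z - P) / u * \<psi> z)) =
          e * g\<^sup>2 * u * (1 / g * (1 + (z - P) / u * \<psi> z))" by (rule arg_cong)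
      moreover have "e * g\<^sup>2 * u * ((z - P) / u * (- (deriv f z * u\<^sup>2 / (e * g\<^sup>2))) * (1 - (z - P) / u * \<psi> z))
          = - ((z - P) * u * deriv f z * (u - (z - P) * \<psi> z))"
        using u e g by (simp add: divide_simps power2_eq_square)
      moreover have "e * g\<^sup>2 * u * (1 / g * (1 + (z - P) / u * \<psi> z)) = g * (e * (u + (z - P) * \<psi> z))"
        using u e g by (simp add: divide_simps power2_eq_square)
      ultimately have *: "(z - P) * u * deriv f z * (u - (z - P) * \<psi> z) = - g * (e * (u + (z - P) * \<psi> z))"
        by (metis minus_minus mult_minus_left)
      \<comment> \<open>With this relation each expression in \<open>\<psi>\<close> in the equation
        above becomes \<open>v\<close> times one in \<open>\<phi>\<close>, and the common factor
        \<open>v\<close> cancels.\<close>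
      have \<phi>v: "v * \<phi> z = P + \<psi> z" using v by (simp add: \<phi>_def v_def)
      have "v * (1 - z * \<phi> z) = v - z * (v * \<phi> z)" by (simp add: algebra_simps)
      also have "\<dots> = u - (z - P) * \<psi> z" unfolding \<phi>v by (simp add: u_def v_def algebra_simps)
      finally have 2: "u - (z - P) * \<psi> z = v * (1 - z * \<phi> z)" ..
      have "v * ((1 + P\<^sup>2) * (1 + z * \<phi> z) - 2 * P * (\<phi> z + z)) =
          (1 + P\<^sup>2) * (v + z * (v * \<phi> z)) - 2 * P * (v * \<phi> z + v * z)" by (simp add: algebra_simps)
      also have "\<dots> = e * (u + (z - P) * \<psi> z)"
        unfolding \<phi>v by (simp add: u_def v_def e_def power2_eq_square algebra_simps)
      finally have 3: "e * (u + (z - P) * \<psi> z) = v * ((1 + P\<^sup>2) * (1 + z * \<phi> z) - 2 * P * (\<phi> z + z))" ..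
      have "v * ((z - P) * u * deriv f z * (1 - z * \<phi> z)) =
          v * (- g * ((1 + P\<^sup>2) * (1 + z * \<phi> z) - 2 * P * (\<phi> z + z)))"
        using * unfolding 2 3 by (simp add: mult_ac)
      then show ?thesis using v by (simp add: g_def u_def)
    qed
  qed
qed

section \<open>The second Taylor coefficient\<close>

theorem mainTheorem3:
  fixes p :: real and w0 :: complex and f :: "complex \<Rightarrow> complex"
  assumes "0 < p" and "p < 1"
    and "w0 \<noteq> 0"
    and "f \<in> Sigma_star p w0"
  shows "Re (fps_nth (fps_expansion f 0) 2) > 0"
proof -
  define P where "P = complex_of_real p"
  obtain \<phi> where hol\<phi>: "\<phi> holomorphic_on ball 0 1" and \<phi>: "\<And>z. norm z < 1 \<Longrightarrow> norm (\<phi> z) \<le> 1"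
    and ode: "\<And>z. z \<in> ball 0 1 - {P} \<Longrightarrow>
       (z - P) * (1 - P * z) * deriv f z * (1 - z * \<phi> z) =
       (w0 - f z) * ((1 + P\<^sup>2) * (1 + z * \<phi> z) - 2 * P * (\<phi> z + z))"
    using Sigma_star_Schur_function[OF assms(1,2,4)] unfolding P_def by metis
  have P: "P \<noteq> 0" using assms by (simp add: P_def)
  have f: "f holomorphic_on ball 0 1 - {P}" "f 0 = 0" "deriv f 0 = 1"
    using assms(4) by (auto simp: Sigma_star_def P_def)
  have U: "open (ball 0 1 - {P})" "0 \<in> ball 0 1 - {P}" using P by (auto simp: open_Diff)
  define a t \<phi>1 where "a = fps_nth (fps_expansion f 0) 2" and "t = \<phi> 0" and "\<phi>1 = deriv \<phi> 0"
  have a: "deriv (deriv f) 0 = 2 * a"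
    by (simp add: a_def fps_expansion_def numeral_2_eq_2)
  have df: "(f has_field_derivative 1) (at 0)"
    using holomorphic_derivI[OF f(1) U] f(3) by simp
  have ddf: "(deriv f has_field_derivative 2 * a) (at 0)"
    using holomorphic_derivI[OF holomorphic_deriv[OF f(1) U(1)] U] a by simp
  have d\<phi>: "(\<phi> has_field_derivative \<phi>1) (at 0)"
    using holomorphic_derivI[OF hol\<phi> open_ball] by (simp add: \<phi>1_def)
  \<comment> \<open>The coefficients of \<open>z\<close> on the two sides of the equation are
    compared as derivatives at 0; the second coefficient enters through the derivative of
    \<open>deriv f\<close>.\<close>
  have "((\<lambda>z. (z - P) * (1 - P * z) * deriv f z * (1 - z * \<phi> z)) has_field_derivative
      1 + P\<^sup>2 - P * (2 * a) + P * t) (at 0)"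
    by (auto intro!: derivative_eq_intros df ddf d\<phi> simp: f t_def power2_eq_square algebra_simps)
  then have "((\<lambda>z. (w0 - f z) * ((1 + P\<^sup>2) * (1 + z * \<phi> z) - 2 * P * (\<phi> z + z))) has_field_derivative
      1 + P\<^sup>2 - P * (2 * a) + P * t) (at 0)"
    by (rule has_field_derivative_transform_within_open[OF _ U]) (rule ode)
  moreover have "((\<lambda>z. (w0 - f z) * ((1 + P\<^sup>2) * (1 + z * \<phi> z) - 2 * P * (\<phi> z + z))) has_field_derivative
      - (1 + P\<^sup>2 - 2 * P * t) + w0 * ((1 + P\<^sup>2) * t - 2 * P * (\<phi>1 + 1))) (at 0)"
    by (auto intro!: derivative_eq_intros df d\<phi> simp: f t_def)
  ultimately have e1: "1 + P\<^sup>2 - P * (2 * a) + P * t =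
      - (1 + P\<^sup>2 - 2 * P * t) + w0 * ((1 + P\<^sup>2) * t - 2 * P * (\<phi>1 + 1))"
    by (rule DERIV_unique)
  \<comment> \<open>The constant terms at 0 tie \<open>w0\<close> to \<open>t\<close>. Divided by
    \<open>P\<close> they give \<open>w0 * N = - 1\<close>, which eliminates \<open>w0\<close> and
    also shows that \<open>N\<close> is nonzero.\<close>
  have e0: "- P = w0 * (1 + P\<^sup>2 - 2 * P * t)"
    using ode[OF U(2)] by (simp add: f t_def)
  define A where "A = p + 1 / p"
  define N where "N = of_real A - 2 * t"
  have PA: "1 + P\<^sup>2 = P * of_real A"
    using P by (simp add: A_def P_def power2_eq_square field_simps)
  have "- P = P * (w0 * N)" using e0 unfolding PA N_def by (simp add: algebra_simps)
  then have wN: "w0 * N = - 1" using P by (metis mult_cancel_left mult_minus1_right)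
  then have N0: "N \<noteq> 0" by auto
  have "P * (of_real A - 2 * a + t) = P * (- N + w0 * (of_real A * t - 2 * (\<phi>1 + 1)))"
    using e1 unfolding PA N_def by (simp add: algebra_simps)
  then have "of_real A - 2 * a + t = - N + w0 * (of_real A * t - 2 * (\<phi>1 + 1))" using P by simp
  \<comment> \<open>Multiplying by \<open>N\<close> makes \<open>w0\<close> appear only in the
    product \<open>w0 * N\<close>, which is then replaced by -1.\<close>
  then have "N * (of_real A - 2 * a + t) = - N * N + (w0 * N) * (of_real A * t - 2 * (\<phi>1 + 1))"
    by (simp only:) (simp add: algebra_simps)
  then have "2 * (N * a) = 2 * (N * of_real A + (t\<^sup>2 - 1 - \<phi>1))"
    unfolding wN unfolding N_def by (simp add: power2_eq_square algebra_simps)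
  then have "N * a = N * of_real A + (t\<^sup>2 - 1 - \<phi>1)" by (metis mult_cancel_left zero_neq_numeral)
  then have "a = of_real A + (t\<^sup>2 - 1 - \<phi>1) / N" using N0 by (simp add: field_simps)
  moreover have "A > 2"
  proof -
    have "(1 - p)\<^sup>2 > 0" using assms by simp
    then show ?thesis using assms by (simp add: A_def field_simps power2_eq_square)
  qed
  moreover have "norm \<phi>1 \<le> 1 - (norm t)\<^sup>2"
    unfolding t_def \<phi>1_def using hol\<phi> \<phi> by (intro Schwarz_Pick_deriv_0) auto
  ultimately show ?thesis
    using coefficient_formula_Re_pos[of A t \<phi>1] \<phi>[of 0] by (simp add: a_def N_def t_def)
qed

end
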